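(* Suppose that $X,Y$ are two injective metric spaces, $A \subset X$ is a set that spans $X$, and $B \subset Y$ is a set that spans $Y$. Then \[ d_{\mathrm{GH}}(X,Y) \le 2\,d_{\mathrm{GH}}(A,B). \]
   Context: The distance of two points $x,x'$ in a metric space is written $|xx'|$; subsets carry the induced metric. A metric space $Y$ is called injective if for any isometric embedding $i \colon A \to B$ of metric spaces and any $1$-Lipschitz (distance-nonincreasing) map $f \colon A \to Y$ there exists a $1$-Lipschitz map $g \colon B \to Y$ with $g \circ i = f$. A subset $A$ of a metric space $X$ spans $X$ if, for every pair $(x,x') \in X \times X$, \[ |xx'| = \sup_{a \in A} \bigl( |xa| - |x'a| \bigr). \] The Hausdorff distance $d^Z_{\mathrm{H}}(X',Y')$ of two subsets $X',Y'$ of a metric space $(Z,d^Z)$ is the infimum of all $\varrho > 0$ such that $X'$ is contained in the open $\varrho$-neighborhood of $Y'$ and vice versa. The Gromov–Hausdorff distance $d_{\mathrm{GH}}(X,Y) \in [0,\infty]$ of two metric spaces $X,Y$ is the infimum of all $\varrho > 0$ for which there exist a metric space $(Z,d^Z)$ and isometric copies $X',Y' \subset Z$ of $X$ and $Y$, respectively, such that $d^Z_{\mathrm{H}}(X',Y') < \varrho$. *)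

theory Defs
  imports "HOL-Analysis.Analysis"
begin

definition isometric_embedding :: "'a metric \<Rightarrow> 'b metric \<Rightarrow> ('a \<Rightarrow> 'b) \<Rightarrow> bool" where
  "isometric_embedding X Z f \<longleftrightarrow>
     f \<in> mspace X \<rightarrow> mspace Z \<and>
     (\<forall>x\<in>mspace X. \<forall>x'\<in>mspace X. mdist Z (f x) (f x') = mdist X x x')"

definition one_Lipschitz :: "'a metric \<Rightarrow> 'b metric \<Rightarrow> ('a \<Rightarrow> 'b) \<Rightarrow> bool" where
  "one_Lipschitz X Y f \<longleftrightarrow>
     f \<in> mspace X \<rightarrow> mspace Y \<and>
     (\<forall>x\<in>mspace X. \<forall>x'\<in>mspace X. mdist Y (f x) (f x') \<le> mdist X x x')"

text \<open>
  HOL cannot quantify over types inside a definition, so the test spaces \<open>A\<close>, \<open>B\<close> below are those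
  whose points lie in \<open>'a option\<close>. This loses nothing: lemma \<open>injective_metric_extends\<close> shows that
  the extension property then holds for test spaces over arbitrary types.
\<close>

definition injective_metric :: "'a metric \<Rightarrow> bool" where
  "injective_metric Y \<longleftrightarrow>
     (\<forall>(A :: 'a option metric) (B :: 'a option metric) i f.
        isometric_embedding A B i \<and> one_Lipschitz A Y f \<longrightarrow>
        (\<exists>g. one_Lipschitz B Y g \<and> (\<forall>a\<in>mspace A. g (i a) = f a)))"

text \<open>
  The supremum is taken in the extended reals, so it is also meaningful for empty \<open>A\<close>
  (with value \<open>-\<infinity>\<close>).
\<close>

definition spans :: "'a metric \<Rightarrow> 'a set \<Rightarrow> bool" where
  "spans X A \<longleftrightarrow>
     A \<subseteq> mspace X \<and>
     (\<forall>x\<in>mspace X. \<forall>x'\<in>mspace X.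
        ereal (mdist X x x') = (SUP a\<in>A. ereal (mdist X x a - mdist X x' a)))"

definition open_nbhd :: "'a metric \<Rightarrow> 'a set \<Rightarrow> real \<Rightarrow> 'a set" where
  "open_nbhd Z S \<rho> = (\<Union>s\<in>S. mball_of Z s \<rho>)"

definition hausdorff_dist :: "'a metric \<Rightarrow> 'a set \<Rightarrow> 'a set \<Rightarrow> ennreal" where
  "hausdorff_dist Z S T =
     Inf {ennreal \<rho> |\<rho>. \<rho> > 0 \<and> S \<subseteq> open_nbhd Z T \<rho> \<and> T \<subseteq> open_nbhd Z S \<rho>}"

text \<open>
  Again the ambient space \<open>Z\<close> has to live over a fixed type. The sum type is large enough: by lemmas
  \<open>gh_ambient_sum\<close> and \<open>gh_dist_le_hausdorff_dist\<close>, an ambient space over any other type can be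
  replaced by one over the sum type without changing the Hausdorff distance of the two copies.
\<close>

definition gh_dist :: "'a metric \<Rightarrow> 'b metric \<Rightarrow> ennreal" where
  "gh_dist X Y =
     Inf {ennreal \<rho> |\<rho>. \<rho> > 0 \<and>
       (\<exists>(Z :: ('a + 'b) metric) f g.
          isometric_embedding X Z f \<and> isometric_embedding Y Z g \<and>
          hausdorff_dist Z (f ` mspace X) (g ` mspace Y) < ennreal \<rho>)}"


subsection \<open>Independence of the chosen types\<close>

lemma injective_metric_nonempty:
  fixes Y :: "'a metric"
  assumes "injective_metric Y"
  shows "mspace Y \<noteq> {}"
proof -
  define E :: "'a option metric" where "E = metric ({}, \<lambda>_ _. 0)"
  define P :: "'a option metric" where "P = metric ({None}, \<lambda>_ _. 0)"
  have "Metric_space ({} :: 'a option set) (\<lambda>_ _. 0)" "Metric_space {None :: 'a option} (\<lambda>_ _. 0)"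
    by (auto simp: Metric_space_def)
  then have "mspace E = {}" "mspace P = {None}"
    by (simp_all add: E_def P_def Metric_space.mspace_metric)
  then have "isometric_embedding E P id" "one_Lipschitz E Y (\<lambda>_. undefined)"
    by (auto simp: isometric_embedding_def one_Lipschitz_def)
  then obtain g where "one_Lipschitz P Y g"
    using assms unfolding injective_metric_def by blast
  then show ?thesis
    using \<open>mspace P = {None}\<close> by (auto simp: one_Lipschitz_def)
qed

lemma injective_metric_one_point:
  fixes Y :: "'a metric"
  assumes inj: "injective_metric Y"
    and nonneg: "\<And>s. s \<in> mspace Y \<Longrightarrow> 0 \<le> r s"
    and lip: "\<And>s t. s \<in> mspace Y \<Longrightarrow> t \<in> mspace Y \<Longrightarrow> r s \<le> mdist Y s t + r t"
    and tri: "\<And>s t. s \<in> mspace Y \<Longrightarrow> t \<in> mspace Y \<Longrightarrow> mdist Y s t \<le> r s + r t"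
  shows "\<exists>y\<in>mspace Y. \<forall>s\<in>mspace Y. mdist Y y s \<le> r s"
proof (cases "\<exists>s\<in>mspace Y. r s = 0")
  case True
  then show ?thesis
    using tri by fastforce
next
  case False
  define D :: "'a option \<Rightarrow> 'a option \<Rightarrow> real" where
    "D u v = (case u of None \<Rightarrow> (case v of None \<Rightarrow> 0 | Some t \<Rightarrow> \<bar>r t\<bar>)
              | Some s \<Rightarrow> (case v of None \<Rightarrow> \<bar>r s\<bar> | Some t \<Rightarrow> mdist Y s t))" for u v
  have D [simp]: "D None None = 0" "D None (Some s) = \<bar>r s\<bar>" "D (Some s) None = \<bar>r s\<bar>"
    "D (Some s) (Some t) = mdist Y s t" for s t
    by (simp_all add: D_def)
  let ?S = "Some ` mspace Y"
  interpret B: Metric_space "insert None ?S" D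
  proof
    show "0 \<le> D x y" for x y
      by (cases x; cases y) auto
    show "D x y = D y x" for x y
      by (cases x; cases y) (auto simp: mdist_commute)
    show "D x y = 0 \<longleftrightarrow> x = y" if "x \<in> insert None ?S" "y \<in> insert None ?S" for x y
      using that False by auto
    show "D x z \<le> D x y + D y z"
      if "x \<in> insert None ?S" "y \<in> insert None ?S" "z \<in> insert None ?S" for x y z
    proof (cases x; cases y; cases z)
      fix s t u assume "x = Some s" "y = Some t" "z = Some u"
      then show ?thesis using that by (auto intro: mdist_triangle)
    next
      fix s t assume "x = None" "y = Some s" "z = Some t"
      then show ?thesis using that lip[of t s] nonneg[of s] nonneg[of t] mdist_commute[of Y s t] by auto
    next
      fix s t assume "x = Some s" "y = None" "z = Some t"
      then show ?thesis using that tri[of s t] nonneg[of s] nonneg[of t] by auto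
    next
      fix s t assume "x = Some s" "y = Some t" "z = None"
      then show ?thesis using that lip[of s t] nonneg[of s] nonneg[of t] by auto
    qed auto
  qed
  interpret A: Metric_space ?S D
    by (rule B.subspace) auto
  have "isometric_embedding (metric (?S, D)) (metric (insert None ?S, D)) id"
    "one_Lipschitz (metric (?S, D)) Y the"
    by (auto simp: isometric_embedding_def one_Lipschitz_def)
  then obtain g where g: "one_Lipschitz (metric (insert None ?S, D)) Y g"
    and ga: "\<forall>a\<in>?S. g (id a) = the a"
    using inj unfolding injective_metric_def by (metis A.mspace_metric)
  have "g None \<in> mspace Y"
    using g by (auto simp: one_Lipschitz_def)
  moreover have "mdist Y (g None) s \<le> r s" if "s \<in> mspace Y" for s
  proof -
    have "mdist Y (g None) (g (Some s)) \<le> D None (Some s)"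
      using g that unfolding one_Lipschitz_def by (metis B.mspace_metric B.mdist_metric image_eqI insertCI)
    then show ?thesis
      using ga that nonneg[OF that] by auto
  qed
  ultimately show ?thesis by blast
qed

theorem injective_metric_extends:
  fixes Y :: "'a metric" and A :: "'b metric" and B :: "'c metric"
  assumes inj: "injective_metric Y"
    and i: "isometric_embedding A B i"
    and f: "one_Lipschitz A Y f"
  shows "\<exists>g. one_Lipschitz B Y g \<and> (\<forall>a\<in>mspace A. g (i a) = f a)"
proof -
  define G0 where "G0 = (\<lambda>a. (i a, f a)) ` mspace A"
  define P where "P G \<longleftrightarrow> G0 \<subseteq> G \<and> G \<subseteq> mspace B \<times> mspace Y \<and>
    (\<forall>p\<in>G. \<forall>q\<in>G. mdist Y (snd p) (snd q) \<le> mdist B (fst p) (fst q))" for G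
  have "P G0"
    using i f by (auto simp: P_def G0_def isometric_embedding_def one_Lipschitz_def)
  have "P (\<Union>C)" if "C \<noteq> {}" and "subset.chain {G. P G} C" for C
  proof -
    have C: "\<And>G. G \<in> C \<Longrightarrow> P G" and
      ch: "\<And>G H. G \<in> C \<Longrightarrow> H \<in> C \<Longrightarrow> G \<subseteq> H \<or> H \<subseteq> G"
      using that(2) by (auto simp: subset_chain_def)
    have "mdist Y (snd p) (snd q) \<le> mdist B (fst p) (fst q)"
      if pq: "p \<in> G" "G \<in> C" "q \<in> H" "H \<in> C" for p q G H
      using ch[OF pq(2,4)] C[OF pq(2)] C[OF pq(4)] pq(1,3) unfolding P_def by blast
    moreover have "G0 \<subseteq> \<Union>C" "\<Union>C \<subseteq> mspace B \<times> mspace Y"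
      using \<open>C \<noteq> {}\<close> C unfolding P_def by blast+
    ultimately show ?thesis
      unfolding P_def by blast
  qed
  then have "\<exists>G\<in>{G. P G}. \<forall>H\<in>{G. P G}. G \<subseteq> H \<longrightarrow> H = G"
    using \<open>P G0\<close> by (intro subset_Zorn_nonempty) auto
  then obtain G where "P G" and max: "\<And>H. P H \<Longrightarrow> G \<subseteq> H \<Longrightarrow> H = G"
    by auto
  have G0: "G0 \<subseteq> G" and sub: "G \<subseteq> mspace B \<times> mspace Y"
    and GL0: "\<forall>p\<in>G. \<forall>q\<in>G. mdist Y (snd p) (snd q) \<le> mdist B (fst p) (fst q)"
    using \<open>P G\<close> by (simp_all add: P_def)
  have GB: "b \<in> mspace B \<and> y \<in> mspace Y" if "(b, y) \<in> G" for b y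
    using sub that by blast
  have GL: "mdist Y y z \<le> mdist B b c" if "(b, y) \<in> G" "(c, z) \<in> G" for b y c z
    using GL0[rule_format, OF that] by simp
  have total: "\<exists>y. (b, y) \<in> G" if b: "b \<in> mspace B" for b
  proof -
    have "\<exists>y\<in>mspace Y. \<forall>p\<in>G. mdist Y y (snd p) \<le> mdist B b (fst p)"
    proof (cases "G = {}")
      case True
      then show ?thesis
        using injective_metric_nonempty[OF inj] by auto
    next
      case False
      define h where "h s p = mdist B (fst p) b + mdist Y s (snd p)" for s p
      define r where "r s = (INF p\<in>G. h s p)" for s
      have bdd: "bdd_below (h s ` G)" for s
        by (rule bdd_belowI[of _ 0]) (auto simp: h_def)
      have le: "r s \<le> h s p" if "p \<in> G" for s p
        unfolding r_def using bdd that by (rule cINF_lower)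
      have ge: "c \<le> r s" if "\<And>p. p \<in> G \<Longrightarrow> c \<le> h s p" for s c
        unfolding r_def using False that by (rule cINF_greatest)
      have "\<exists>y\<in>mspace Y. \<forall>s\<in>mspace Y. mdist Y y s \<le> r s"
      proof (rule injective_metric_one_point[OF inj])
        show "0 \<le> r s" for s
          by (rule ge) (auto simp: h_def)
        show "r s \<le> mdist Y s t + r t" if st: "s \<in> mspace Y" "t \<in> mspace Y" for s t
        proof -
          have "r s - mdist Y s t \<le> h t p" if "p \<in> G" for p
          proof -
            have "mdist Y s (snd p) \<le> mdist Y s t + mdist Y t (snd p)"
              using st GB[of "fst p" "snd p"] that by (intro mdist_triangle) auto
            then show ?thesis
              using le[OF that, of s] by (simp add: h_def)
          qed
          then show ?thesis
            using ge[of "r s - mdist Y s t" t] by simp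
        qed
        show "mdist Y s t \<le> r s + r t" if st: "s \<in> mspace Y" "t \<in> mspace Y" for s t
        proof -
          have "mdist Y s t \<le> h s p + h t q" if p: "p \<in> G" and q: "q \<in> G" for p q
          proof -
            obtain c y d z where pq: "p = (c, y)" "q = (d, z)"
              by (cases p, cases q)
            have mem: "c \<in> mspace B" "y \<in> mspace Y" "d \<in> mspace B" "z \<in> mspace Y"
              using GB p q pq by auto
            have "mdist Y s t \<le> mdist Y s y + mdist Y y t"
              using st mem by (intro mdist_triangle)
            moreover have "mdist Y y t \<le> mdist Y y z + mdist Y z t"
              using st mem by (intro mdist_triangle)
            moreover have "mdist Y y z \<le> mdist B c d"
              using GL p q pq by auto
            moreover have "mdist B c d \<le> mdist B c b + mdist B b d"
              using b mem by (intro mdist_triangle)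
            ultimately show ?thesis
              by (simp add: h_def pq mdist_commute[of Y z t] mdist_commute[of B b d])
          qed
          then have "mdist Y s t - h s p \<le> r t" if "p \<in> G" for p
            using that by (intro ge) (simp add: algebra_simps)
          then have "mdist Y s t - r t \<le> r s"
            by (intro ge) (simp add: algebra_simps)
          then show ?thesis by simp
        qed
      qed
      then obtain y where y: "y \<in> mspace Y" "\<And>s. s \<in> mspace Y \<Longrightarrow> mdist Y y s \<le> r s"
        by blast
      have "mdist Y y (snd p) \<le> mdist B b (fst p)" if "p \<in> G" for p
      proof -
        have mem: "snd p \<in> mspace Y"
          using GB[of "fst p" "snd p"] that by auto
        then show ?thesis
          using y(2)[OF mem] le[OF that, of "snd p"] mdist_zero[OF mem mem, THEN iffD2, OF refl]
          unfolding h_def mdist_commute[of B b] by linarith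
      qed
      then show ?thesis
        using y(1) by blast
    qed
    then obtain y where y: "y \<in> mspace Y" "\<And>p. p \<in> G \<Longrightarrow> mdist Y y (snd p) \<le> mdist B b (fst p)"
      by blast
    have y': "mdist Y (snd p) y \<le> mdist B (fst p) b" if "p \<in> G" for p
      using y(2)[OF that] by (metis mdist_commute)
    have "mdist Y y y \<le> mdist B b b"
      using mdist_zero[OF y(1) y(1), THEN iffD2, OF refl] mdist_nonneg[of B b b] by linarith
    then have "P (insert (b, y) G)"
      using G0 sub GL0 b y y' unfolding P_def by auto
    then show ?thesis
      using max by blast
  qed
  define g where "g b = (SOME y. (b, y) \<in> G)" for b
  have g: "(b, g b) \<in> G" if "b \<in> mspace B" for b
    unfolding g_def using total[OF that] by (rule someI_ex)
  have "one_Lipschitz B Y g"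
    using g GB GL by (auto simp: one_Lipschitz_def)
  moreover have "g (i a) = f a" if a: "a \<in> mspace A" for a
  proof -
    have ia: "i a \<in> mspace B" and "(i a, f a) \<in> G"
      using a i G0 by (auto simp: G0_def isometric_embedding_def)
    then have "mdist Y (g (i a)) (f a) \<le> mdist B (i a) (i a)"
      using g GL by blast
    moreover have "mdist B (i a) (i a) = 0"
      using ia by simp
    ultimately have "mdist Y (g (i a)) (f a) = 0"
      by (metis mdist_nonneg order_antisym)
    then show ?thesis
      using GB g[OF ia] \<open>(i a, f a) \<in> G\<close> by (metis mdist_zero)
  qed
  ultimately show ?thesis by blast
qed

lemma hausdorff_dist_isometric_image:
  assumes "isometric_embedding W Z h" and "S \<subseteq> mspace W" and "T \<subseteq> mspace W"
  shows "hausdorff_dist Z (h ` S) (h ` T) = hausdorff_dist W S T"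
proof -
  have "h ` S \<subseteq> open_nbhd Z (h ` T) \<rho> \<longleftrightarrow> S \<subseteq> open_nbhd W T \<rho>"
    if "S \<subseteq> mspace W" "T \<subseteq> mspace W" for S T \<rho>
  proof -
    have "h s \<in> mball_of Z (h t) \<rho> \<longleftrightarrow> s \<in> mball_of W t \<rho>" if "s \<in> S" "t \<in> T" for s t
      using assms(1) that \<open>S \<subseteq> mspace W\<close> \<open>T \<subseteq> mspace W\<close>
      by (auto simp: isometric_embedding_def subset_iff Pi_iff)
    then show ?thesis
      unfolding open_nbhd_def image_subset_iff subset_iff UN_iff by blast
  qed
  then show ?thesis
    using assms(2,3) by (simp add: hausdorff_dist_def)
qed

lemma gh_ambient_sum:
  fixes X :: "'a metric" and Y :: "'b metric" and Z :: "'c metric"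
  assumes f: "isometric_embedding X Z f" and g: "isometric_embedding Y Z g"
  shows "\<exists>(W :: ('a + 'b) metric) f' g'. isometric_embedding X W f' \<and> isometric_embedding Y W g' \<and>
    hausdorff_dist W (f' ` mspace X) (g' ` mspace Y) =
    hausdorff_dist Z (f ` mspace X) (g ` mspace Y)"
proof -
  define N where "N = f ` mspace X \<union> g ` mspace Y"
  define k where "k z = (if z \<in> f ` mspace X then Inl (inv_into (mspace X) f z)
     else Inr (inv_into (mspace Y) g z))" for z
  define h where "h = case_sum f g"
  have hk: "h (k z) = z" if "z \<in> N" for z
    using that by (auto simp: N_def h_def k_def f_inv_into_f)
  have NZ: "N \<subseteq> mspace Z"
    using f g by (auto simp: N_def isometric_embedding_def)
  define d where "d u v = mdist Z (h u) (h v)" for u v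
  interpret W: Metric_space "k ` N" d
  proof
    show "0 \<le> d x y" "d x y = d y x" for x y
      by (simp_all add: d_def mdist_commute)
    show "d x y = 0 \<longleftrightarrow> x = y" if "x \<in> k ` N" "y \<in> k ` N" for x y
      using that NZ by (auto simp: d_def hk subset_iff)
    show "d x z \<le> d x y + d y z" if "x \<in> k ` N" "y \<in> k ` N" "z \<in> k ` N" for x y z
      using that NZ by (auto simp: d_def hk subset_iff intro!: mdist_triangle)
  qed
  define W where "W = metric (k ` N, d)"
  have W: "mspace W = k ` N" "mdist W = d"
    by (simp_all add: W_def)
  have "isometric_embedding X W (k \<circ> f)"
    using f by (auto simp: isometric_embedding_def W d_def hk N_def)
  moreover have "isometric_embedding Y W (k \<circ> g)"
    using g by (auto simp: isometric_embedding_def W d_def hk N_def)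
  moreover have "isometric_embedding W Z h"
    using NZ by (auto simp: isometric_embedding_def W d_def hk)
  then have "hausdorff_dist Z (h ` (k \<circ> f) ` mspace X) (h ` (k \<circ> g) ` mspace Y) =
      hausdorff_dist W ((k \<circ> f) ` mspace X) ((k \<circ> g) ` mspace Y)"
    by (rule hausdorff_dist_isometric_image) (auto simp: W N_def)
  moreover have "h ` (k \<circ> f) ` mspace X = f ` mspace X" "h ` (k \<circ> g) ` mspace Y = g ` mspace Y"
    by (auto simp: image_image hk N_def)
  ultimately show ?thesis
    by (intro exI[of _ W] exI[of _ "k \<circ> f"] exI[of _ "k \<circ> g"]) simp
qed

theorem gh_dist_le_hausdorff_dist:
  fixes X :: "'a metric" and Y :: "'b metric" and Z :: "'c metric"
  assumes "isometric_embedding X Z f" and "isometric_embedding Y Z g"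
  shows "gh_dist X Y \<le> hausdorff_dist Z (f ` mspace X) (g ` mspace Y)"
proof (rule dense_ge)
  fix e assume e: "hausdorff_dist Z (f ` mspace X) (g ` mspace Y) < e"
  show "gh_dist X Y \<le> e"
  proof (cases e rule: ennreal_cases)
    case (real \<rho>)
    have "0 < e"
      using e by (rule le_less_trans[OF zero_le])
    then have "\<rho> > 0"
      using real by simp
    obtain W :: "('a + 'b) metric" and f' g' where
      "isometric_embedding X W f'" "isometric_embedding Y W g'"
      "hausdorff_dist W (f' ` mspace X) (g' ` mspace Y) < ennreal \<rho>"
      using gh_ambient_sum[OF assms] e unfolding real(2) by force
    then show ?thesis
      unfolding gh_dist_def real using \<open>\<rho> > 0\<close> by (intro Inf_lower) blast
  qed simp
qed

end

theory Submission
  imports Defs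
begin

text \<open>
  Place \<open>A\<close> and \<open>B\<close> in a common space \<open>Z\<close> in which each lies in the open \<open>\<rho>\<close>-neighbourhood of the
  other. Injectivity of \<open>Y\<close> is used twice: the inclusion of \<open>B\<close> into \<open>Y\<close> extends to a 1-Lipschitz
  map on \<open>Z\<close>, and the restriction of that map to \<open>A\<close> extends to a 1-Lipschitz map
  \<open>\<phi> : X \<rightarrow> Y\<close>. It satisfies \<open>|\<phi>(a) b| \<le> |a b|\<close>, the right-hand side being measured in \<open>Z\<close>
  (lemma \<open>injective_metric_transfer\<close>). Symmetrically there is a 1-Lipschitz map \<open>\<psi> : Y \<rightarrow> X\<close>.

  Going from \<open>a \<in> A\<close> to a point \<open>b \<in> B\<close> near it shows that \<open>\<psi> \<circ> \<phi>\<close> moves \<open>a\<close> by at most \<open>2\<rho>\<close>.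
  As \<open>A\<close> spans \<open>X\<close>, and distances to points of \<open>A\<close> therefore determine all distances, \<open>\<psi> \<circ> \<phi>\<close> moves
  no point of \<open>X\<close> by more than \<open>2\<rho>\<close> (lemma \<open>spans_displacement\<close>); likewise for \<open>\<phi> \<circ> \<psi>\<close> on \<open>Y\<close>.

  Finally \<open>max |\<phi>(x) y| |x \<psi>(y)|\<close> is a pseudometric extension of the two metrics to the disjoint
  union of \<open>X\<close> and \<open>Y\<close>, and in it \<open>x\<close> and \<open>\<phi>(x)\<close>, as well as \<open>\<psi>(y)\<close> and \<open>y\<close>, are at distance at
  most \<open>2\<rho>\<close> (lemma \<open>gh_dist_le_displacement\<close>). So \<open>X\<close> and \<open>Y\<close> have Gromov-Hausdorff distance at
  most \<open>2\<rho>\<close>, where \<open>\<rho>\<close> can be taken arbitrarily close to the distance of \<open>A\<close> and \<open>B\<close>.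
\<close>


section \<open>1-Lipschitz maps, injective spaces and spanning sets\<close>

lemma one_Lipschitz_compose:
  assumes "one_Lipschitz X Y f" and "one_Lipschitz Y Z g"
  shows "one_Lipschitz X Z (g \<circ> f)"
  unfolding one_Lipschitz_def
proof (intro conjI ballI)
  show "g \<circ> f \<in> mspace X \<rightarrow> mspace Z"
    using assms by (auto simp: one_Lipschitz_def)
  fix x x' assume x: "x \<in> mspace X" "x' \<in> mspace X"
  then have "mdist Z (g (f x)) (g (f x')) \<le> mdist Y (f x) (f x')"
    using assms by (simp add: one_Lipschitz_def Pi_iff)
  also have "\<dots> \<le> mdist X x x'"
    using assms x by (simp add: one_Lipschitz_def)
  finally show "mdist Z ((g \<circ> f) x) ((g \<circ> f) x') \<le> mdist X x x'"
    by simp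
qed

lemma isometric_embedding_imp_one_Lipschitz:
  "isometric_embedding X Z f \<Longrightarrow> one_Lipschitz X Z f"
  by (simp add: isometric_embedding_def one_Lipschitz_def)

lemma isometric_embedding_submetric:
  "isometric_embedding (submetric X A) X id"
  by (auto simp: isometric_embedding_def)

text \<open>
  Extending in two steps, first over \<open>Z\<close> and then over \<open>X\<close>, avoids gluing \<open>X\<close> to \<open>Z\<close> along \<open>A\<close>.
\<close>

lemma injective_metric_transfer:
  fixes X :: "'a metric" and Y :: "'b metric" and Z :: "'c metric"
  assumes inj: "injective_metric Y"
    and A: "A \<subseteq> mspace X" and B: "B \<subseteq> mspace Y"
    and f: "isometric_embedding (submetric X A) Z f"
    and g: "isometric_embedding (submetric Y B) Z g"
  obtains \<phi> where "one_Lipschitz X Y \<phi>"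
    and "\<And>a b. a \<in> A \<Longrightarrow> b \<in> B \<Longrightarrow> mdist Y (\<phi> a) b \<le> mdist Z (f a) (g b)"
proof -
  have "one_Lipschitz (submetric Y B) Y id"
    by (rule isometric_embedding_imp_one_Lipschitz[OF isometric_embedding_submetric])
  then obtain h where h: "one_Lipschitz Z Y h"
    and hg: "\<forall>b\<in>mspace (submetric Y B). h (g b) = id b"
    using injective_metric_extends[OF inj g] by blast
  have "one_Lipschitz (submetric X A) Y (h \<circ> f)"
    using isometric_embedding_imp_one_Lipschitz[OF f] h by (rule one_Lipschitz_compose)
  then obtain \<phi> where \<phi>: "one_Lipschitz X Y \<phi>"
    and \<phi>A: "\<forall>a\<in>mspace (submetric X A). \<phi> (id a) = (h \<circ> f) a"
    using injective_metric_extends[OF inj isometric_embedding_submetric] by blast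
  have "mdist Y (\<phi> a) b \<le> mdist Z (f a) (g b)" if "a \<in> A" "b \<in> B" for a b
  proof -
    have mem: "a \<in> mspace (submetric X A)" "b \<in> mspace (submetric Y B)"
      using that A B by auto
    have "f a \<in> mspace Z" "g b \<in> mspace Z"
      using f g mem unfolding isometric_embedding_def by blast+
    then have "mdist Y (h (f a)) (h (g b)) \<le> mdist Z (f a) (g b)"
      using h by (simp add: one_Lipschitz_def)
    then show ?thesis
      using \<phi>A hg mem by simp
  qed
  with \<phi> show thesis by (rule that)
qed

text \<open>
  For \<open>a \<in> A\<close> one has \<open>|\<theta>(x) a| \<le> |\<theta>(x) \<theta>(a)| + r \<le> |x a| + r\<close>, so every term of the supremum
  that computes \<open>|\<theta>(x) x|\<close> is at most \<open>r\<close>.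
\<close>

lemma spans_displacement:
  assumes A: "spans X A" and \<theta>: "one_Lipschitz X X \<theta>"
    and small: "\<And>a. a \<in> A \<Longrightarrow> mdist X (\<theta> a) a \<le> r"
    and x: "x \<in> mspace X"
  shows "mdist X (\<theta> x) x \<le> r"
proof -
  have \<theta>_mem: "\<theta> z \<in> mspace X" if "z \<in> mspace X" for z
    using \<theta> that by (auto simp: one_Lipschitz_def)
  have "mdist X (\<theta> x) a - mdist X x a \<le> r" if "a \<in> A" for a
  proof -
    have a: "a \<in> mspace X"
      using A that by (auto simp: spans_def)
    have "mdist X (\<theta> x) a \<le> mdist X (\<theta> x) (\<theta> a) + mdist X (\<theta> a) a"
      using x a \<theta>_mem by (intro mdist_triangle)
    moreover have "mdist X (\<theta> x) (\<theta> a) \<le> mdist X x a"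
      using \<theta> x a by (simp add: one_Lipschitz_def)
    ultimately show ?thesis
      using small[OF that] by linarith
  qed
  then have "(SUP a\<in>A. ereal (mdist X (\<theta> x) a - mdist X x a)) \<le> ereal r"
    by (intro SUP_least) simp
  moreover have "ereal (mdist X (\<theta> x) x) = (SUP a\<in>A. ereal (mdist X (\<theta> x) a - mdist X x a))"
    using A x \<theta>_mem[OF x] unfolding spans_def by blast
  ultimately have "ereal (mdist X (\<theta> x) x) \<le> ereal r"
    by (rule ord_eq_le_trans[rotated])
  then show ?thesis by simp
qed

text \<open>
  The composite \<open>\<psi> \<circ> \<phi>\<close> moves \<open>a \<in> A\<close> by at most \<open>|\<psi>(\<phi>(a)) \<psi>(b)| + |\<psi>(b) a| \<le> 2 \<delta> a b\<close> for
  every \<open>b \<in> B\<close>, and spanning carries the resulting bound from \<open>A\<close> to all of \<open>X\<close>. Here \<open>\<delta> a b\<close>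
  stands for the distance of \<open>a\<close> and \<open>b\<close> in a space containing \<open>A\<close> and \<open>B\<close>.
\<close>

lemma transfer_displacement:
  assumes A: "spans X A" and B: "B \<subseteq> mspace Y"
    and \<phi>: "one_Lipschitz X Y \<phi>" and \<psi>: "one_Lipschitz Y X \<psi>"
    and \<phi>_le: "\<And>a b. a \<in> A \<Longrightarrow> b \<in> B \<Longrightarrow> mdist Y (\<phi> a) b \<le> \<delta> a b"
    and \<psi>_le: "\<And>a b. a \<in> A \<Longrightarrow> b \<in> B \<Longrightarrow> mdist X (\<psi> b) a \<le> \<delta> a b"
    and near: "\<And>a. a \<in> A \<Longrightarrow> \<exists>b\<in>B. \<delta> a b \<le> \<rho>"
    and x: "x \<in> mspace X"
  shows "mdist X (\<psi> (\<phi> x)) x \<le> 2 * \<rho>"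
proof -
  have "mdist X ((\<psi> \<circ> \<phi>) a) a \<le> 2 * \<rho>" if a: "a \<in> A" for a
  proof -
    obtain b where b: "b \<in> B" "\<delta> a b \<le> \<rho>"
      using near[OF a] by blast
    have mem: "a \<in> mspace X" "b \<in> mspace Y" "\<phi> a \<in> mspace Y" "\<psi> (\<phi> a) \<in> mspace X" "\<psi> b \<in> mspace X"
      using A B a b \<phi> \<psi> by (auto simp: spans_def one_Lipschitz_def)
    have "mdist X (\<psi> (\<phi> a)) a \<le> mdist X (\<psi> (\<phi> a)) (\<psi> b) + mdist X (\<psi> b) a"
      using mem by (intro mdist_triangle)
    moreover have "mdist X (\<psi> (\<phi> a)) (\<psi> b) \<le> mdist Y (\<phi> a) b"
      using \<psi> mem by (simp add: one_Lipschitz_def)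
    ultimately show ?thesis
      using \<phi>_le[OF a b(1)] \<psi>_le[OF a b(1)] b(2) by simp
  qed
  then have "mdist X ((\<psi> \<circ> \<phi>) x) x \<le> 2 * \<rho>"
    by (rule spans_displacement[OF A one_Lipschitz_compose[OF \<phi> \<psi>] _ x])
  then show ?thesis by simp
qed


section \<open>Metrics on disjoint unions\<close>

text \<open>
  If \<open>\<phi>\<close> and \<open>\<psi>\<close> are 1-Lipschitz, then \<open>max |\<phi>(x) y| |x \<psi>(y)|\<close> satisfies all mixed triangle
  inequalities: \<open>|x x'| \<le> |x \<psi>(y)| + |\<psi>(y) x'|\<close> bounds distances within \<open>X\<close>, the detour through
  \<open>\<phi>(x)\<close> gives the analogous bound within \<open>Y\<close>, and the Lipschitz conditions handle the
  remaining ones. A small positive constant is added between the two sides so that distinct points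
  have positive distance.
\<close>

lemma gh_dist_le_displacement:
  fixes X :: "'a metric" and Y :: "'b metric"
  assumes \<phi>: "one_Lipschitz X Y \<phi>" and \<psi>: "one_Lipschitz Y X \<psi>"
    and r: "0 \<le> r"
    and \<psi>\<phi>: "\<And>x. x \<in> mspace X \<Longrightarrow> mdist X (\<psi> (\<phi> x)) x \<le> r"
    and \<phi>\<psi>: "\<And>y. y \<in> mspace Y \<Longrightarrow> mdist Y (\<phi> (\<psi> y)) y \<le> r"
  shows "gh_dist X Y \<le> ennreal r"
proof (rule ennreal_le_epsilon)
  fix e :: real assume "0 < e"
  have mem: "\<And>x. x \<in> mspace X \<Longrightarrow> \<phi> x \<in> mspace Y" "\<And>y. y \<in> mspace Y \<Longrightarrow> \<psi> y \<in> mspace X"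
    using \<phi> \<psi> by (auto simp: one_Lipschitz_def)
  have \<phi>_le: "mdist Y (\<phi> x) (\<phi> x') \<le> mdist X x x'" if "x \<in> mspace X" "x' \<in> mspace X" for x x'
    using \<phi> that by (simp add: one_Lipschitz_def)
  have \<psi>_le: "mdist X (\<psi> y) (\<psi> y') \<le> mdist Y y y'" if "y \<in> mspace Y" "y' \<in> mspace Y" for y y'
    using \<psi> that by (simp add: one_Lipschitz_def)
  \<comment> \<open>Half of \<open>e\<close> makes the distances positive; the other half is the slack needed for open
    neighbourhoods of radius \<open>r + e\<close>.\<close>
  define m where "m x y = max (mdist Y (\<phi> x) y) (mdist X x (\<psi> y)) + e/2" for x y
  have m_pos: "0 < m x y" for x y
    using \<open>0 < e\<close> unfolding m_def by (intro add_nonneg_pos) (simp_all add: le_max_iff_disj)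
  have m_tri_X: "m x y \<le> mdist X x x' + m x' y"
    if "x \<in> mspace X" "x' \<in> mspace X" "y \<in> mspace Y" for x x' y
    using \<phi>_le[of x x'] mdist_triangle[of "\<phi> x" Y "\<phi> x'" y] mdist_triangle[of x X x' "\<psi> y"] that mem
    by (auto simp: m_def)
  have m_tri_Y: "m x y \<le> m x y' + mdist Y y' y"
    if "x \<in> mspace X" "y \<in> mspace Y" "y' \<in> mspace Y" for x y y'
    using \<psi>_le[of y' y] mdist_triangle[of "\<phi> x" Y y' y] mdist_triangle[of x X "\<psi> y'" "\<psi> y"] that mem
    by (auto simp: m_def)
  have X_tri: "mdist X x x' \<le> m x y + m x' y"
    if "x \<in> mspace X" "x' \<in> mspace X" "y \<in> mspace Y" for x x' y
    using mdist_triangle[of x X "\<psi> y" x'] mdist_commute[of X "\<psi> y" x'] that mem \<open>0 < e\<close>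
    by (auto simp: m_def)
  have Y_tri: "mdist Y y y' \<le> m x y + m x y'"
    if "x \<in> mspace X" "y \<in> mspace Y" "y' \<in> mspace Y" for x y y'
    using mdist_triangle[of y Y "\<phi> x" y'] mdist_commute[of Y "\<phi> x" y] that mem \<open>0 < e\<close>
    by (auto simp: m_def)
  define d where "d u v = (case u of
      Inl x \<Rightarrow> (case v of Inl x' \<Rightarrow> mdist X x x' | Inr y \<Rightarrow> m x y)
    | Inr y \<Rightarrow> (case v of Inl x \<Rightarrow> m x y | Inr y' \<Rightarrow> mdist Y y y'))" for u v
  have d: "d (Inl x) (Inl x') = mdist X x x'" "d (Inl x) (Inr y) = m x y"
    "d (Inr y) (Inl x) = m x y" "d (Inr y) (Inr y') = mdist Y y y'" for x x' y y'
    by (simp_all add: d_def)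
  have pos: "0 \<le> d u v" and sym: "d u v = d v u" for u v
    using m_pos by (cases u; cases v; auto simp: d mdist_commute less_imp_le)+
  interpret W: Metric_space "mspace X <+> mspace Y" d
  proof
    show "0 \<le> d u v" "d u v = d v u" for u v
      by (fact pos sym)+
    show "d u v = 0 \<longleftrightarrow> u = v" if "u \<in> mspace X <+> mspace Y" "v \<in> mspace X <+> mspace Y" for u v
      using that m_pos by (auto simp: d less_imp_neq[symmetric])
    show "d u w \<le> d u v + d v w"
      if "u \<in> mspace X <+> mspace Y" "v \<in> mspace X <+> mspace Y" "w \<in> mspace X <+> mspace Y"
      for u v w
      using that
    proof (elim PlusE; simp only: d)
      fix x x' x'' assume "x \<in> mspace X" "x' \<in> mspace X" "x'' \<in> mspace X"
      then show "mdist X x x'' \<le> mdist X x x' + mdist X x' x''"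
        by (rule mdist_triangle)
    next
      fix x x' y assume "x \<in> mspace X" "x' \<in> mspace X" "y \<in> mspace Y"
      then show "m x y \<le> mdist X x x' + m x' y" "m x y \<le> m x' y + mdist X x' x"
        "mdist X x x' \<le> m x y + m x' y"
        using m_tri_X[of x x' y] X_tri[of x x' y] by (simp_all add: mdist_commute)
    next
      fix x y y' assume "x \<in> mspace X" "y \<in> mspace Y" "y' \<in> mspace Y"
      then show "m x y \<le> m x y' + mdist Y y' y" "m x y \<le> mdist Y y y' + m x y'"
        "mdist Y y y' \<le> m x y + m x y'"
        using m_tri_Y[of x y y'] Y_tri[of x y y'] by (simp_all add: mdist_commute)
    next
      fix y y' y'' assume "y \<in> mspace Y" "y' \<in> mspace Y" "y'' \<in> mspace Y"
      then show "mdist Y y y'' \<le> mdist Y y y' + mdist Y y' y''"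
        by (rule mdist_triangle)
    qed
  qed
  define W where "W = metric (mspace X <+> mspace Y, d)"
  have W: "mspace W = mspace X <+> mspace Y" "mdist W = d"
    by (simp_all add: W_def)
  have Inl: "isometric_embedding X W Inl" and Inr: "isometric_embedding Y W Inr"
    by (auto simp: isometric_embedding_def W d)
  have zero: "x \<in> mspace X \<Longrightarrow> mdist X x x = 0" "y \<in> mspace Y \<Longrightarrow> mdist Y y y = 0" for x y
    by simp_all
  have "m x (\<phi> x) < r + e" if "x \<in> mspace X" for x
    using \<psi>\<phi>[OF that] zero(2)[OF mem(1)[OF that]] mdist_commute[of X x "\<psi> (\<phi> x)"]
      \<open>0 < e\<close> r
    by (auto simp: m_def max_def)
  then have "Inl ` mspace X \<subseteq> open_nbhd W (Inr ` mspace Y) (r + e)"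
    using mem by (fastforce simp: open_nbhd_def in_mball_of W d)
  moreover have "m (\<psi> y) y < r + e" if "y \<in> mspace Y" for y
    using \<phi>\<psi>[OF that] zero(1)[OF mem(2)[OF that]] \<open>0 < e\<close> r
    by (auto simp: m_def max_def)
  then have "Inr ` mspace Y \<subseteq> open_nbhd W (Inl ` mspace X) (r + e)"
    using mem by (fastforce simp: open_nbhd_def in_mball_of W d)
  ultimately have "hausdorff_dist W (Inl ` mspace X) (Inr ` mspace Y) \<le> ennreal (r + e)"
    unfolding hausdorff_dist_def using r \<open>0 < e\<close> by (intro Inf_lower CollectI exI[of _ "r + e"]) simp
  then have "gh_dist X Y \<le> ennreal (r + e)"
    by (rule order_trans[OF gh_dist_le_hausdorff_dist[OF Inl Inr]])
  then show "gh_dist X Y \<le> ennreal r + ennreal e"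
    using r \<open>0 < e\<close> by simp
qed


section \<open>Comparing Gromov-Hausdorff distances\<close>

lemma hausdorff_dist_less_imp_near:
  assumes "hausdorff_dist Z S T < ennreal \<rho>"
  shows "\<And>s. s \<in> S \<Longrightarrow> \<exists>t\<in>T. mdist Z s t \<le> \<rho>" and "\<And>t. t \<in> T \<Longrightarrow> \<exists>s\<in>S. mdist Z s t \<le> \<rho>"
proof -
  obtain \<rho>' where \<rho>': "0 < \<rho>'" "ennreal \<rho>' < ennreal \<rho>"
    and S: "S \<subseteq> open_nbhd Z T \<rho>'" and T: "T \<subseteq> open_nbhd Z S \<rho>'"
    using assms unfolding hausdorff_dist_def Inf_less_iff by blast
  have le: "\<rho>' \<le> \<rho>"
    using \<rho>' by (simp add: ennreal_less_iff)
  show "\<exists>t\<in>T. mdist Z s t \<le> \<rho>" if s: "s \<in> S" for s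
  proof -
    obtain t where "t \<in> T" "mdist Z t s < \<rho>'"
      using S s by (auto simp: open_nbhd_def)
    then show ?thesis
      using le by (auto simp: mdist_commute[of Z s] intro!: bexI[of _ t])
  qed
  show "\<exists>s\<in>S. mdist Z s t \<le> \<rho>" if t: "t \<in> T" for t
  proof -
    obtain s where "s \<in> S" "mdist Z s t < \<rho>'"
      using T t by (auto simp: open_nbhd_def)
    then show ?thesis
      using le by (auto intro!: bexI[of _ s])
  qed
qed

theorem theorem3p1:
  fixes X :: "'a metric" and Y :: "'b metric" and A :: "'a set" and B :: "'b set"
  assumes "injective_metric X" and "injective_metric Y"
    and "spans X A" and "spans Y B"
  shows "gh_dist X Y \<le> 2 * gh_dist (submetric X A) (submetric Y B)"
proof -
  have sub: "A \<subseteq> mspace X" "B \<subseteq> mspace Y"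
    using assms(3,4) by (auto simp: spans_def)
  then have msp: "mspace (submetric X A) = A" "mspace (submetric Y B) = B"
    by auto
  have bound: "gh_dist X Y \<le> ennreal (2 * \<rho>)"
    if \<rho>: "0 < \<rho>" and f: "isometric_embedding (submetric X A) Z f"
      and g: "isometric_embedding (submetric Y B) Z g"
      and H: "hausdorff_dist Z (f ` A) (g ` B) < ennreal \<rho>"
    for \<rho> f g and Z :: "('a + 'b) metric"
  proof -
    obtain \<phi> where \<phi>: "one_Lipschitz X Y \<phi>"
      and \<phi>_le: "\<And>a b. a \<in> A \<Longrightarrow> b \<in> B \<Longrightarrow> mdist Y (\<phi> a) b \<le> mdist Z (f a) (g b)"
      using injective_metric_transfer[OF assms(2) sub f g] by blast
    obtain \<psi> where \<psi>: "one_Lipschitz Y X \<psi>"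
      and \<psi>_le': "\<And>b a. b \<in> B \<Longrightarrow> a \<in> A \<Longrightarrow> mdist X (\<psi> b) a \<le> mdist Z (g b) (f a)"
      using injective_metric_transfer[OF assms(1) sub(2,1) g f] by blast
    have \<psi>_le: "mdist X (\<psi> b) a \<le> mdist Z (f a) (g b)" if "a \<in> A" "b \<in> B" for a b
      using \<psi>_le'[OF that(2,1)] by (simp add: mdist_commute)
    have near: "\<And>a. a \<in> A \<Longrightarrow> \<exists>b\<in>B. mdist Z (f a) (g b) \<le> \<rho>"
      "\<And>b. b \<in> B \<Longrightarrow> \<exists>a\<in>A. mdist Z (f a) (g b) \<le> \<rho>"
      using hausdorff_dist_less_imp_near[OF H] by blast+
    show ?thesis
    proof (rule gh_dist_le_displacement[OF \<phi> \<psi>])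
      show "0 \<le> 2 * \<rho>"
        using \<rho> by simp
      show "mdist X (\<psi> (\<phi> x)) x \<le> 2 * \<rho>" if "x \<in> mspace X" for x
        using \<phi>_le \<psi>_le near(1) that by (rule transfer_displacement[OF assms(3) sub(2) \<phi> \<psi>])
      show "mdist Y (\<phi> (\<psi> y)) y \<le> 2 * \<rho>" if "y \<in> mspace Y" for y
        using \<psi>_le \<phi>_le near(2) that by (rule transfer_displacement[OF assms(4) sub(1) \<psi> \<phi>])
    qed
  qed
  \<comment> \<open>Halving the left-hand side, instead of moving the factor \<open>2\<close> into the infimum, allows comparing
    with each admissible \<open>\<rho>\<close> separately.\<close>
  have "gh_dist X Y / 2 \<le> gh_dist (submetric X A) (submetric Y B)"
    unfolding gh_dist_def[of "submetric X A"] msp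
  proof (rule Inf_greatest, clarify)
    fix \<rho> f g and Z :: "('a + 'b) metric"
    assume "0 < \<rho>" "isometric_embedding (submetric X A) Z f"
      "isometric_embedding (submetric Y B) Z g" "hausdorff_dist Z (f ` A) (g ` B) < ennreal \<rho>"
    then have "gh_dist X Y \<le> ennreal (2 * \<rho>)"
      by (rule bound)
    then show "gh_dist X Y / 2 \<le> ennreal \<rho>"
      using \<open>0 < \<rho>\<close> by (simp add: ennreal_mult divide_le_posI_ennreal)
  qed
  then have "2 * (gh_dist X Y / 2) \<le> 2 * gh_dist (submetric X A) (submetric Y B)"
    by (rule mult_left_mono) simp
  then show ?thesis
    by (simp add: ennreal_times_divide ennreal_mult_divide_eq mult.commute)
qed

end
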